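(* Suppose that the Dirichlet series $f(s)=\sum_{n=1}^\infty a_n n^{-s}$, $a_n\in\mathbb{C}$, has multiplicative coefficients. Then $\sigma_a(f)=\sigma_b(f)$.
   Context: An (ordinary) Dirichlet series is a series $f(s)=\sum_{n=1}^\infty a_n n^{-s}$ with complex coefficients $a_n$ and $s=\sigma+it$, where $\sigma,t\in\mathbb{R}$. Its coefficients are multiplicative if $a_{mn}=a_m a_n$ whenever $m,n$ are positive integers with $\gcd(m,n)=1$. The abscissas of uniform and absolute convergence are $$\sigma_b(f)=\inf\Big\{\sigma\in\mathbb{R} : \sum_{n=1}^\infty a_n n^{-\sigma-it}\text{ converges uniformly for } t\in\mathbb{R}\Big\},\qquad \sigma_a(f)=\inf\Big\{\sigma\in\mathbb{R} : \sum_{n=1}^\infty |a_n| n^{-\sigma}\text{ converges}\Big\},$$ with the infima taken in the extended real line $[-\infty,+\infty]$ (so $\inf\emptyset=+\infty$). *)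

theory Defs
  imports "HOL-Analysis.Analysis" "HOL-Library.Extended_Real"
begin

(* A Dirichlet series is given by its coefficient function a :: nat => complex, of which only
   the values at positive arguments are ever used: the value a 0 is irrelevant. *)

definition multiplicative_coeffs :: "(nat \<Rightarrow> complex) \<Rightarrow> bool" where
  "multiplicative_coeffs a \<longleftrightarrow>
     (\<forall>m n. m > 0 \<longrightarrow> n > 0 \<longrightarrow> coprime m n \<longrightarrow> a (m * n) = a m * a n)"

definition dirichlet_partial_sum :: "(nat \<Rightarrow> complex) \<Rightarrow> nat \<Rightarrow> complex \<Rightarrow> complex" where
  "dirichlet_partial_sum a N s = (\<Sum>n = 1..N. a n * of_nat n powr (- s))"

definition abscissa_unif_conv :: "(nat \<Rightarrow> complex) \<Rightarrow> ereal" where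
  "abscissa_unif_conv a =
     Inf (ereal ` {\<sigma>. uniformly_convergent_on UNIV
                         (\<lambda>N t. dirichlet_partial_sum a N (Complex \<sigma> t))})"

(* The series is shifted by one index so that it starts at n = 1. *)
definition abscissa_abs_conv :: "(nat \<Rightarrow> complex) \<Rightarrow> ereal" where
  "abscissa_abs_conv a =
     Inf (ereal ` {\<sigma>. summable (\<lambda>n. cmod (a (Suc n)) * real (Suc n) powr (- \<sigma>))})"

end

theory Submission
  imports Defs "HOL-Computational_Algebra.Primes"
begin

text \<open>
  Absolute convergence on a vertical line forces uniform convergence there (Weierstrass), so the
  content is that uniform convergence on the line with real part \<open>\<sigma>\<close> forces absolute convergence
  to the right of it. Replacing \<open>a n\<close> by \<open>a n * n powr (-\<sigma>)\<close> keeps multiplicativity and moves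
  the line to the imaginary axis; uniform convergence then bounds the partial sums
  \<open>S N t = (\<Sum>n\<le>N. a n * n powr (-i t))\<close> by a constant \<open>C\<close>, uniformly in \<open>t\<close> and in all large \<open>N\<close>.
  A multiplicative \<open>a\<close> vanishes on the positive integers unless \<open>a 1 = 1\<close>, so only this case needs an
  argument.

  The multiplicative structure enters through a Riesz product. For a finite set \<open>Q\<close> of pairwise
  coprime integers \<open>q \<ge> 2\<close> and numbers \<open>w q\<close> in the closed unit disc, the kernel
  \<open>K t = (\<Prod>q\<in>Q. 1 + Re (w q * q powr (i t)))\<close> is nonnegative. Expanding it and averaging over \<open>t\<close>
  picks out of \<open>S N * K\<close> the terms whose frequencies cancel. By coprimality these are the terms
  where \<open>n\<close> is a product of distinct elements of \<open>Q\<close>, and multiplicativity of \<open>a\<close> folds their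
  sum back into a product: the mean of \<open>S N * K\<close> is \<open>\<Prod>q\<in>Q. 1 + w q * a q / 2\<close>
  (\<open>has_mean_riesz_product\<close>). For the series with the single term \<open>1\<close> this says that \<open>K\<close> has
  mean \<open>1\<close>, so the product is at most \<open>C\<close> in modulus. When \<open>w q\<close> turns \<open>a q\<close> into its modulus, the
  result is \<open>(\<Sum>q\<in>Q. norm (a q)) \<le> 2 * C\<close> (\<open>sum_coprime_coeffs_le\<close>).

  For finitely many primes \<open>p\<close> and a bounded range of exponents, let \<open>Q\<close> contain for each \<open>p\<close> a
  power whose coefficient has the largest modulus \<open>m p\<close>. Hence \<open>\<Sum>p. m p\<close> is at most \<open>2 * C\<close>.
  The Euler factor at \<open>p\<close> of the series of
  \<open>norm (a n) * n powr (-\<delta>)\<close> is at most \<open>1 + m p * B\<close>, where \<open>B\<close> bounds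
  \<open>\<Sum>k. p powr (-k * \<delta>)\<close> for all \<open>p\<close>, so all partial sums of that series are at most
  \<open>exp (2 * C * B)\<close> (\<open>summable_norm_twist_if_bounded\<close>).
\<close>

section \<open>Mean values of trigonometric polynomials\<close>

text \<open>
  The integrability clause keeps the limit meaningful: the integral of a function that is not
  integrable has the default value \<open>0\<close>. For \<open>T < 0\<close> the interval is empty and the clause is void.
\<close>
definition has_mean :: "(real \<Rightarrow> complex) \<Rightarrow> complex \<Rightarrow> bool" where
  "has_mean f m \<longleftrightarrow>
     (\<forall>T. f integrable_on {0..T}) \<and> ((\<lambda>T. integral {0..T} f /\<^sub>R T) \<longlongrightarrow> m) at_top"

lemma has_mean_sum:
  assumes "finite I" "\<And>i. i \<in> I \<Longrightarrow> has_mean (f i) (m i)"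
  shows "has_mean (\<lambda>t. \<Sum>i\<in>I. f i t) (\<Sum>i\<in>I. m i)"
proof -
  have int: "f i integrable_on {0..T}" if "i \<in> I" for i T
    using assms(2)[OF that] by (simp add: has_mean_def)
  have eq: "integral {0..T} (\<lambda>t. \<Sum>i\<in>I. f i t) /\<^sub>R T = (\<Sum>i\<in>I. integral {0..T} (f i) /\<^sub>R T)" for T
    using assms(1) int by (simp add: integral_sum scaleR_sum_right)
  have "((\<lambda>T. \<Sum>i\<in>I. integral {0..T} (f i) /\<^sub>R T) \<longlongrightarrow> (\<Sum>i\<in>I. m i)) at_top"
    using assms(2) by (intro tendsto_sum) (simp add: has_mean_def)
  with eq int assms(1) show ?thesis
    by (simp add: has_mean_def integrable_sum)
qed

lemma has_mean_cmult:
  assumes "has_mean f m"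
  shows "has_mean (\<lambda>t. c * f t) (c * m)"
proof -
  have eq: "integral {0..T} (\<lambda>t. c * f t) /\<^sub>R T = c * (integral {0..T} f /\<^sub>R T)" for T
    by simp
  show ?thesis
    using assms unfolding has_mean_def eq
    by (intro conjI allI tendsto_mult_left integrable_on_mult_right) auto
qed

text \<open>
  Orthogonality of characters: for \<open>x \<noteq> 0\<close> the primitive \<open>cis (x * t) / (\<i> * x)\<close> is bounded, so
  dividing its increment by \<open>T\<close> gives \<open>0\<close> in the limit.
\<close>
lemma has_mean_cis:
  "has_mean (\<lambda>t. cis (x * t)) (if x = 0 then 1 else 0)"
proof -
  have int: "(\<lambda>t. cis (x * t)) integrable_on {0..T}" for T
    by (intro integrable_continuous_interval continuous_intros)
  have "((\<lambda>T. integral {0..T} (\<lambda>t. cis (x * t)) /\<^sub>R T) \<longlongrightarrow> (if x = 0 then 1 else 0)) at_top"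
  proof (cases "x = 0")
    case True
    have "eventually (\<lambda>T. integral {0..T} (\<lambda>t. cis (x * t)) /\<^sub>R T = 1) at_top"
      using eventually_gt_at_top[of 0]
      by eventually_elim (use True in \<open>simp add: scaleR_conv_of_real\<close>)
    then show ?thesis using True by (simp add: tendsto_eventually)
  next
    case False
    have ftc: "((\<lambda>t. cis (x * t)) has_integral (cis (x * T) - 1) / (\<i> * x)) {0..T}" if "T > 0" for T
    proof -
      have "((\<lambda>t. cis (x * t) / (\<i> * x)) has_vector_derivative cis (x * t)) (at t within {0..T})" for t
        using False unfolding cis_conv_exp
        by (auto intro!: derivative_eq_intros has_vector_derivative_real_field simp: field_simps)
      from fundamental_theorem_of_calculus[of 0 T, OF _ this] that show ?thesis
        by (simp add: diff_divide_distrib)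
    qed
    have "eventually (\<lambda>T. norm (integral {0..T} (\<lambda>t. cis (x * t)) /\<^sub>R T) \<le> (2 / \<bar>x\<bar>) * inverse T) at_top"
      using eventually_gt_at_top[of 0]
    proof eventually_elim
      case (elim T)
      have "norm (cis (x * T) - 1) \<le> 2"
        using norm_triangle_ineq4[of "cis (x * T)" 1] by simp
      then have "norm ((cis (x * T) - 1) / (\<i> * x)) \<le> 2 / \<bar>x\<bar>"
        by (simp add: norm_divide norm_mult divide_right_mono)
      then have "norm (integral {0..T} (\<lambda>t. cis (x * t))) \<le> 2 / \<bar>x\<bar>"
        by (simp only: integral_unique[OF ftc[OF elim]])
      then have "norm (integral {0..T} (\<lambda>t. cis (x * t))) * inverse T \<le> (2 / \<bar>x\<bar>) * inverse T"
        using elim by (intro mult_right_mono) auto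
      then show ?case using elim by (simp add: mult.commute)
    qed
    moreover have "((\<lambda>T. (2 / \<bar>x\<bar>) * inverse T) \<longlongrightarrow> 0) at_top"
      by (rule tendsto_mult_right_zero[OF tendsto_inverse_0_at_top[OF filterlim_ident]])
    ultimately show ?thesis
      using False by (simp add: Lim_null_comparison)
  qed
  with int show ?thesis by (simp add: has_mean_def)
qed

text \<open>
  This is where nonnegativity of the Riesz product pays off: a bound for \<open>S N\<close> that is uniform in
  \<open>t\<close> passes to the mean of \<open>S N * K\<close> and costs only the mean of \<open>K\<close>, not its supremum.
\<close>
lemma has_mean_norm_le:
  assumes f: "has_mean f m" and K: "has_mean (\<lambda>t. complex_of_real (K t)) (complex_of_real \<kappa>)"
    and le: "\<And>t. norm (f t) \<le> C * K t"
  shows "norm m \<le> C * \<kappa>"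
proof -
  have KT: "K integrable_on {0..T} \<and> integral {0..T} (\<lambda>t. complex_of_real (K t)) = of_real (integral {0..T} K)" for T
  proof -
    have "(\<lambda>t. Re (complex_of_real (K t))) integrable_on {0..T}"
      using K integrable_linear[OF _ bounded_linear_Re] unfolding has_mean_def o_def by blast
    then show ?thesis
      using integral_linear[OF _ bounded_linear_of_real] by (simp add: o_def)
  qed
  have "((\<lambda>T. complex_of_real (integral {0..T} K / T)) \<longlongrightarrow> of_real \<kappa>) at_top"
    using K KT unfolding has_mean_def by (simp add: scaleR_conv_of_real field_simps)
  then have limK: "((\<lambda>T. integral {0..T} K / T) \<longlongrightarrow> \<kappa>) at_top"
    by (simp only: tendsto_of_real_iff)
  have "eventually (\<lambda>T. norm (integral {0..T} f /\<^sub>R T) \<le> C * (integral {0..T} K / T)) at_top"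
    using eventually_gt_at_top[of 0]
  proof eventually_elim
    case (elim T)
    have "norm (integral {0..T} f) \<le> integral {0..T} (\<lambda>t. C * K t)"
      using f KT le by (intro integral_norm_bound_integral integrable_on_mult_right) (auto simp: has_mean_def)
    then show ?case using elim by (simp add: field_simps)
  qed
  moreover have "((\<lambda>T. norm (integral {0..T} f /\<^sub>R T)) \<longlongrightarrow> norm m) at_top"
    using f by (intro tendsto_norm) (simp add: has_mean_def)
  ultimately show ?thesis
    using tendsto_le[OF trivial_limit_at_top_linorder tendsto_mult_left[OF limK]] by blast
qed

section \<open>Multiplicative coefficients\<close>

lemma multiplicative_coeffs_prod:
  fixes h :: "'i \<Rightarrow> nat"
  assumes mult: "multiplicative_coeffs a" and one: "a 1 = 1" and "finite A"
    and pos: "\<And>x. x \<in> A \<Longrightarrow> h x > 0"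
    and cop: "\<And>x y. x \<in> A \<Longrightarrow> y \<in> A \<Longrightarrow> x \<noteq> y \<Longrightarrow> coprime (h x) (h y)"
  shows "a (\<Prod>x\<in>A. h x) = (\<Prod>x\<in>A. a (h x))"
  using \<open>finite A\<close> pos cop
proof (induction A rule: finite_induct)
  case empty
  then show ?case using one by simp
next
  case (insert x A)
  have "coprime (h x) (\<Prod>y\<in>A. h y)"
    using insert by (intro prod_coprime_right) auto
  moreover have "(\<Prod>y\<in>A. h y) > 0" using insert by (intro prod_pos) auto
  ultimately have "a (h x * (\<Prod>y\<in>A. h y)) = a (h x) * a (\<Prod>y\<in>A. h y)"
    using mult insert unfolding multiplicative_coeffs_def by auto
  then show ?case using insert by simp
qed

lemma multiplicative_coeffs_twist:
  assumes "multiplicative_coeffs a"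
  shows "multiplicative_coeffs (\<lambda>n. a n * of_real (real n powr x))"
  using assms unfolding multiplicative_coeffs_def by (simp add: powr_mult)

section \<open>Riesz products over coprime integers\<close>

text \<open>
  The left-hand side says that a signed product of elements of \<open>Q\<close> equals \<open>n\<close>. An element with
  exponent \<open>-1\<close> would divide the product of those with exponent \<open>1\<close>, which is impossible because
  it is coprime to each of them and greater than \<open>1\<close>. So an integral signed product is an honest
  product. This identifies the frequencies of the Riesz product that resonate with a Dirichlet
  polynomial.
\<close>
lemma signed_log_sum_eq_ln_iff:
  fixes Q :: "nat set" and e :: "nat \<Rightarrow> int"
  assumes fin: "finite Q" and ge2: "\<And>q. q \<in> Q \<Longrightarrow> q \<ge> 2"
    and cop: "\<And>q r. q \<in> Q \<Longrightarrow> r \<in> Q \<Longrightarrow> q \<noteq> r \<Longrightarrow> coprime q r"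
    and e: "e \<in> PiE Q (\<lambda>_. {-1, 0, 1})" and n: "n > 0"
  shows "(\<Sum>q\<in>Q. of_int (e q) * ln (real q)) = ln (real n) \<longleftrightarrow>
           e \<in> PiE Q (\<lambda>_. {0, 1}) \<and> n = (\<Prod>q\<in>Q. q ^ nat (e q))"
proof
  define A where "A = {q \<in> Q. e q = 1}"
  define B where "B = {q \<in> Q. e q = -1}"
  have finAB: "finite A" "finite B" using fin by (auto simp: A_def B_def)
  have posAB: "\<Prod>A > 0" "\<Prod>B > 0"
    using ge2 by (auto simp: A_def B_def intro!: prod_pos dest!: ge2)
  have cases: "e q = -1 \<or> e q = 0 \<or> e q = 1" if "q \<in> Q" for q
    using e that by (auto simp: PiE_iff)
  have lnprod: "ln (real (\<Prod>D)) = (\<Sum>q\<in>D. ln (real q))" if "D \<subseteq> Q" for D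
  proof -
    have "finite D" using that fin finite_subset by blast
    moreover have "real q \<noteq> 0" if "q \<in> D" for q using \<open>D \<subseteq> Q\<close> ge2 that by force
    ultimately show ?thesis by (simp add: ln_prod)
  qed
  have "(\<Sum>q\<in>Q. of_int (e q) * ln (real q))
        = (\<Sum>q\<in>Q. (if e q = 1 then ln (real q) else 0) - (if e q = -1 then ln (real q) else 0))"
    using cases by (intro sum.cong) force+
  also have "\<dots> = (\<Sum>q\<in>A. ln (real q)) - (\<Sum>q\<in>B. ln (real q))"
    using fin by (simp add: sum_subtractf A_def B_def sum.inter_filter)
  finally have split: "(\<Sum>q\<in>Q. of_int (e q) * ln (real q)) = ln (real (\<Prod>A)) - ln (real (\<Prod>B))"
    using lnprod[of A] lnprod[of B] by (simp add: A_def B_def)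
  have prodA: "(\<Prod>q\<in>Q. q ^ nat (e q)) = \<Prod>A" 
  proof -
    have "(\<Prod>q\<in>Q. q ^ nat (e q)) = (\<Prod>q\<in>Q. if e q = 1 then q else 1)"
      using cases by (intro prod.cong) force+
    then show ?thesis using fin by (simp add: A_def prod.inter_filter)
  qed
  \<comment> \<open>Exponentiating the hypothesis and clearing denominators gives \<open>\<Prod>A = n * \<Prod>B\<close>.\<close>
  {
    assume "(\<Sum>q\<in>Q. of_int (e q) * ln (real q)) = ln (real n)"
    then have "ln (real (\<Prod>A)) = ln (real n) + ln (real (\<Prod>B))"
      using split by simp
    also have "\<dots> = ln (real (n * \<Prod>B))"
      using n posAB by (simp add: ln_mult del: of_nat_prod)
    finally have "real (\<Prod>A) = real (n * \<Prod>B)"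
      using n posAB by (simp del: of_nat_prod of_nat_mult)
    then have eq: "\<Prod>A = n * \<Prod>B" by (simp only: of_nat_eq_iff)
    have "B = {}"
    proof (rule ccontr)
      assume "B \<noteq> {}"
      then obtain q where q: "q \<in> B" by blast
      then have "q dvd \<Prod>A" using eq finAB dvd_prodI[of B q "\<lambda>x. x"] by simp
      moreover have "coprime q (\<Prod>A)"
        using q by (intro prod_coprime_right cop) (auto simp: A_def B_def)
      ultimately have "q = 1" using coprime_common_divisor[of q "\<Prod>A" q] by simp
      then show False using q ge2[of q] by (auto simp: B_def)
    qed
    then have "e q \<in> {0, 1}" if "q \<in> Q" for q
      using cases[OF that] that by (auto simp: B_def)
    then have "e \<in> PiE Q (\<lambda>_. {0, 1})" using e by (simp add: PiE_iff)
    moreover have "n = \<Prod>A" using eq \<open>B = {}\<close> by simp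
    ultimately show "e \<in> PiE Q (\<lambda>_. {0, 1}) \<and> n = (\<Prod>q\<in>Q. q ^ nat (e q))"
      using prodA by simp
  }
  {
    assume "e \<in> PiE Q (\<lambda>_. {0, 1}) \<and> n = (\<Prod>q\<in>Q. q ^ nat (e q))"
    then have range: "e \<in> PiE Q (\<lambda>_. {0, 1})" and n_eq: "n = \<Prod>A" using prodA by simp_all
    have "B = {}" using PiE_mem[OF range] by (force simp: B_def)
    then show "(\<Sum>q\<in>Q. of_int (e q) * ln (real q)) = ln (real n)"
      using split n_eq by simp
  }
qed

definition riesz_product :: "nat set \<Rightarrow> (nat \<Rightarrow> complex) \<Rightarrow> real \<Rightarrow> real" where
  "riesz_product Q w t = (\<Prod>q\<in>Q. 1 + Re (w q * cis (ln (real q) * t)))"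

lemma riesz_product_nonneg:
  assumes "\<And>q. q \<in> Q \<Longrightarrow> norm (w q) \<le> 1"
  shows "riesz_product Q w t \<ge> 0"
  unfolding riesz_product_def
proof (rule prod_nonneg)
  fix q assume "q \<in> Q"
  have "\<bar>Re (w q * cis (ln (real q) * t))\<bar> \<le> norm (w q * cis (ln (real q) * t))"
    by (rule abs_Re_le_cmod)
  also have "\<dots> \<le> 1" using assms[OF \<open>q \<in> Q\<close>] by (simp add: norm_mult)
  finally show "0 \<le> 1 + Re (w q * cis (ln (real q) * t))" by linarith
qed

text \<open>
  In the expansion of the Riesz product each \<open>q\<close> contributes a frequency \<open>e * ln q\<close> with
  \<open>e \<in> {-1, 0, 1}\<close>. Against the term \<open>n\<close> of the Dirichlet polynomial only those exponent vectors
  survive whose total frequency is \<open>ln n\<close>, that is, vectors with entries in \<open>{0, 1}\<close> whose product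
  is \<open>n\<close>. The condition on \<open>N\<close> ensures that each of these products occurs as some \<open>n \<le> N\<close>. As
  \<open>a\<close> is multiplicative, the surviving sum is again the expansion of a product over \<open>Q\<close>.
\<close>
lemma has_mean_riesz_product:
  fixes Q :: "nat set" and w :: "nat \<Rightarrow> complex"
  assumes mult: "multiplicative_coeffs a" and one: "a 1 = 1"
    and fin: "finite Q" and ge2: "\<And>q. q \<in> Q \<Longrightarrow> q \<ge> 2"
    and cop: "\<And>q r. q \<in> Q \<Longrightarrow> r \<in> Q \<Longrightarrow> q \<noteq> r \<Longrightarrow> coprime q r"
    and N: "N \<ge> \<Prod>Q"
  shows "has_mean (\<lambda>t. (\<Sum>n=1..N. a n * cis (- (ln (real n) * t))) * of_real (riesz_product Q w t))
           (\<Prod>q\<in>Q. 1 + w q * a q / 2)"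
proof -
  define c :: "nat \<Rightarrow> int \<Rightarrow> complex" where
    "c q e = (if e = 0 then 1 else if e = 1 then w q / 2 else cnj (w q) / 2)" for q e
  define E where "E = PiE Q (\<lambda>_. {-1, 0, 1::int})"
  define F where "F = PiE Q (\<lambda>_. {0, 1::int})"
  define L where "L e = (\<Sum>q\<in>Q. of_int (e q) * ln (real q))" for e :: "nat \<Rightarrow> int"
  \<comment> \<open>\<open>L e\<close> is the frequency of the exponent vector \<open>e\<close>; for \<open>e \<in> F\<close> it is the logarithm of \<open>\<nu> e\<close>.\<close>
  define \<nu> where "\<nu> e = (\<Prod>q\<in>Q. q ^ nat (e q))" for e :: "nat \<Rightarrow> int"
  have finE: "finite E" using fin by (simp add: E_def finite_PiE)
  have FE: "F \<subseteq> E" unfolding E_def F_def by (intro PiE_mono) auto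
  have factor: "complex_of_real (1 + Re (w q * cis x)) = (\<Sum>e\<in>{-1,0,1}. c q e * cis (of_int e * x))" for q x
    by (simp add: c_def complex_eq_iff field_simps)
  have cis_sum: "cis (\<Sum>q\<in>A. g q) = (\<Prod>q\<in>A. cis (g q))" for g :: "nat \<Rightarrow> real" and A
    by (induction A rule: infinite_finite_induct) (auto simp: cis_mult[symmetric])
  have K: "of_real (riesz_product Q w t) = (\<Sum>e\<in>E. (\<Prod>q\<in>Q. c q (e q)) * cis (L e * t))" for t
  proof -
    have "complex_of_real (riesz_product Q w t)
          = (\<Prod>q\<in>Q. \<Sum>e\<in>{-1,0,1}. c q e * cis (of_int e * (ln (real q) * t)))"
      unfolding riesz_product_def of_real_prod factor ..
    also have "\<dots> = (\<Sum>e\<in>E. \<Prod>q\<in>Q. c q (e q) * cis (of_int (e q) * (ln (real q) * t)))"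
      unfolding E_def using fin by (intro prod_sum_PiE) auto
    also have "\<dots> = (\<Sum>e\<in>E. (\<Prod>q\<in>Q. c q (e q)) * cis (L e * t))"
      by (simp add: prod.distrib L_def cis_sum[symmetric] sum_distrib_right mult.assoc)
    finally show ?thesis .
  qed
  have \<nu>_range: "\<nu> e \<in> {1..N}" if "e \<in> F" for e
  proof -
    have "\<nu> e \<le> \<Prod>Q" unfolding \<nu>_def
    proof (rule prod_mono)
      fix q assume "q \<in> Q"
      then have "e q = 0 \<or> e q = 1" using that by (auto simp: F_def PiE_iff)
      then show "0 \<le> q ^ nat (e q) \<and> q ^ nat (e q) \<le> q" using ge2[OF \<open>q \<in> Q\<close>] by auto
    qed
    moreover have "\<nu> e > 0" unfolding \<nu>_def using ge2 by (intro prod_pos) fastforce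
    ultimately show ?thesis using N by simp
  qed
  have a\<nu>: "a (\<nu> e) = (\<Prod>q\<in>Q. a (q ^ nat (e q)))" for e
    unfolding \<nu>_def
  proof (rule multiplicative_coeffs_prod[OF mult one fin])
    show "q ^ nat (e q) > 0" if "q \<in> Q" for q using ge2[OF that] by simp
    show "coprime (q ^ nat (e q)) (r ^ nat (e r))" if "q \<in> Q" "r \<in> Q" "q \<noteq> r" for q r
      using cop[OF that] by simp
  qed
  have "has_mean (\<lambda>t. \<Sum>n\<in>{1..N}. \<Sum>e\<in>E. (a n * (\<Prod>q\<in>Q. c q (e q))) * cis ((L e - ln (real n)) * t))
          (\<Sum>n\<in>{1..N}. \<Sum>e\<in>E. (a n * (\<Prod>q\<in>Q. c q (e q))) * (if L e - ln (real n) = 0 then 1 else 0))"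
    using finE by (intro has_mean_sum has_mean_cmult has_mean_cis) auto
  also have "(\<lambda>t. \<Sum>n\<in>{1..N}. \<Sum>e\<in>E. (a n * (\<Prod>q\<in>Q. c q (e q))) * cis ((L e - ln (real n)) * t))
     = (\<lambda>t. (\<Sum>n=1..N. a n * cis (- (ln (real n) * t))) * of_real (riesz_product Q w t))"
  proof
    fix t
    have "cis ((L e - ln (real n)) * t) = cis (- (ln (real n) * t)) * cis (L e * t)" for e n
      by (simp add: cis_mult algebra_simps)
    then show "(\<Sum>n\<in>{1..N}. \<Sum>e\<in>E. (a n * (\<Prod>q\<in>Q. c q (e q))) * cis ((L e - ln (real n)) * t))
     = (\<Sum>n=1..N. a n * cis (- (ln (real n) * t))) * of_real (riesz_product Q w t)"
      unfolding K sum_product by (simp only: mult_ac)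
  qed
  also have "(\<Sum>n\<in>{1..N}. \<Sum>e\<in>E. (a n * (\<Prod>q\<in>Q. c q (e q))) * (if L e - ln (real n) = 0 then 1 else 0))
     = (\<Sum>n\<in>{1..N}. \<Sum>e\<in>E. if e \<in> F \<and> n = \<nu> e then a n * (\<Prod>q\<in>Q. c q (e q)) else 0)"
  proof (intro sum.cong refl)
    fix n e assume "n \<in> {1..N}" "e \<in> E"
    then have "L e = ln (real n) \<longleftrightarrow> e \<in> F \<and> n = \<nu> e"
      using signed_log_sum_eq_ln_iff[OF fin ge2 cop, of e n] unfolding L_def F_def \<nu>_def E_def by auto
    then show "(a n * (\<Prod>q\<in>Q. c q (e q))) * (if L e - ln (real n) = 0 then 1 else 0)
       = (if e \<in> F \<and> n = \<nu> e then a n * (\<Prod>q\<in>Q. c q (e q)) else 0)" by simp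
  qed
  also have "\<dots> = (\<Sum>e\<in>E. \<Sum>n\<in>{1..N}. if e \<in> F \<and> n = \<nu> e then a n * (\<Prod>q\<in>Q. c q (e q)) else 0)"
    by (rule sum.swap)
  also have "\<dots> = (\<Sum>e\<in>E. if e \<in> F then a (\<nu> e) * (\<Prod>q\<in>Q. c q (e q)) else 0)"
  proof (intro sum.cong refl)
    fix e assume "e \<in> E"
    show "(\<Sum>n\<in>{1..N}. if e \<in> F \<and> n = \<nu> e then a n * (\<Prod>q\<in>Q. c q (e q)) else 0)
      = (if e \<in> F then a (\<nu> e) * (\<Prod>q\<in>Q. c q (e q)) else 0)"
      using \<nu>_range[of e] by (cases "e \<in> F") auto
  qed
  also have "\<dots> = (\<Sum>e\<in>F. a (\<nu> e) * (\<Prod>q\<in>Q. c q (e q)))"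
    using FE finE by (simp add: sum.If_cases Int_absorb1)
  also have "\<dots> = (\<Sum>e\<in>F. \<Prod>q\<in>Q. a (q ^ nat (e q)) * c q (e q))"
    by (simp add: a\<nu> prod.distrib)
  also have "\<dots> = (\<Prod>q\<in>Q. \<Sum>e\<in>{0,1}. a (q ^ nat e) * c q e)"
    unfolding F_def using fin by (intro prod_sum_PiE[symmetric]) auto
  also have "\<dots> = (\<Prod>q\<in>Q. 1 + w q * a q / 2)"
    using one by (simp add: c_def mult.commute)
  finally show ?thesis .
qed

text \<open>
  The means of \<open>S N * K\<close> and of \<open>K\<close> bound \<open>\<Prod>q\<in>Q. 1 + norm (a q) / 2\<close> by \<open>C\<close>, for every \<open>Q\<close> with
  the same \<open>C\<close>; the sum follows since it is dominated by the product.
\<close>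
lemma sum_coprime_coeffs_le:
  fixes Q :: "nat set"
  assumes mult: "multiplicative_coeffs a" and one: "a 1 = 1"
    and bound: "\<And>N t. N \<ge> N0 \<Longrightarrow> norm (\<Sum>n=1..N. a n * cis (- (ln (real n) * t))) \<le> C"
    and fin: "finite Q" and ge2: "\<And>q. q \<in> Q \<Longrightarrow> q \<ge> 2"
    and cop: "\<And>q r. q \<in> Q \<Longrightarrow> r \<in> Q \<Longrightarrow> q \<noteq> r \<Longrightarrow> coprime q r"
  shows "(\<Sum>q\<in>Q. norm (a q)) \<le> 2 * C"
proof -
  \<comment> \<open>This rotation makes \<open>w q * a q\<close> equal to the modulus of \<open>a q\<close>.\<close>
  define w where "w q = cnj (sgn (a q))" for q
  define N where "N = max N0 (\<Prod>Q)"
  have w: "norm (w q) \<le> 1" for q by (simp add: w_def norm_sgn)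
  have wa: "w q * a q = of_real (norm (a q))" for q
  proof (cases "a q = 0")
    case False
    have "cnj (a q) * a q = of_real (norm (a q)) * of_real (norm (a q))"
      by (simp add: mult.commute[of "cnj _"] complex_norm_square[symmetric] power2_eq_square)
    with False show ?thesis by (simp add: w_def sgn_eq)
  qed (simp add: w_def)
  \<comment> \<open>The coefficients of the constant series 1 are multiplicative, and they yield the mean of the
    Riesz product itself.\<close>
  define u :: "nat \<Rightarrow> complex" where "u n = (if n = 1 then 1 else 0)" for n
  have "multiplicative_coeffs u"
    by (auto simp: multiplicative_coeffs_def u_def)
  from has_mean_riesz_product[OF this _ fin ge2 cop order_refl, of w]
  have "has_mean (\<lambda>t. (\<Sum>n=1..\<Prod>Q. u n * cis (- (ln (real n) * t))) * of_real (riesz_product Q w t))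
           (\<Prod>q\<in>Q. 1 + w q * u q / 2)" by (auto simp: u_def)
  moreover have "(\<Prod>q\<in>Q. 1 + w q * u q / 2) = 1"
    using ge2 by (intro prod.neutral) (fastforce simp: u_def)
  moreover have "(\<Sum>n=1..\<Prod>Q. u n * cis (- (ln (real n) * t))) = 1" for t
  proof -
    have "\<Prod>Q \<ge> 1" using ge2 by (intro prod_ge_1) force
    then show ?thesis by (simp add: u_def if_distrib[of "\<lambda>x. x * _"] cong: if_cong)
  qed
  ultimately have meanK: "has_mean (\<lambda>t. of_real (riesz_product Q w t)) (of_real 1)" by simp
  have "has_mean (\<lambda>t. (\<Sum>n=1..N. a n * cis (- (ln (real n) * t))) * of_real (riesz_product Q w t))
           (\<Prod>q\<in>Q. 1 + w q * a q / 2)"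
    by (rule has_mean_riesz_product[OF mult one fin ge2 cop]) (auto simp: N_def)
  moreover note meanK
  moreover have "norm ((\<Sum>n=1..N. a n * cis (- (ln (real n) * t))) * of_real (riesz_product Q w t))
        \<le> C * riesz_product Q w t" for t
    using bound[of N t] riesz_product_nonneg[of Q w t] w
    by (simp add: norm_mult N_def mult_right_mono)
  ultimately have "norm (\<Prod>q\<in>Q. 1 + w q * a q / 2) \<le> C * 1"
    by (rule has_mean_norm_le)
  also have "(\<Prod>q\<in>Q. 1 + w q * a q / 2) = of_real (\<Prod>q\<in>Q. 1 + norm (a q) / 2)"
    by (simp add: wa)
  also have "norm (complex_of_real (\<Prod>q\<in>Q. 1 + norm (a q) / 2)) = (\<Prod>q\<in>Q. 1 + norm (a q) / 2)"
    by (simp only: norm_of_real) (simp add: abs_prod add_nonneg_nonneg)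
  finally have "(\<Prod>q\<in>Q. 1 + norm (a q) / 2) \<le> C" by simp
  moreover have "(\<Sum>q\<in>Q. norm (a q) / 2) \<le> (\<Prod>q\<in>Q. 1 + norm (a q) / 2)"
    by (rule sum_le_prod) simp
  ultimately show ?thesis by (simp add: sum_divide_distrib[symmetric])
qed

section \<open>From Euler factors to absolute convergence\<close>

text \<open>
  Sending \<open>n \<le> N\<close> to its vector of prime exponents is injective, and each exponent is below \<open>N\<close>
  because \<open>2 ^ k \<le> n\<close>. So every term on the left appears once in the expansion of the product,
  whose other terms are nonnegative.
\<close>
lemma sum_norm_le_euler_product:
  assumes mult: "multiplicative_coeffs a" and one: "a 1 = 1"
  shows "(\<Sum>n=1..N. norm (a n)) \<le> (\<Prod>p | prime p \<and> p \<le> N. \<Sum>k=0..N. norm (a (p ^ k)))"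
proof -
  define P where "P = {p::nat. prime p \<and> p \<le> N}"
  define \<nu> where "\<nu> n = restrict (\<lambda>p. multiplicity p n) P" for n :: nat
  have finP: "finite P" by (simp add: P_def)
  have fact: "n = (\<Prod>p\<in>P. p ^ \<nu> n p)" if "n \<in> {1..N}" for n
  proof -
    have "n = (\<Prod>p\<in>prime_factors n. p ^ multiplicity p n)"
      using that by (intro prime_factorization_nat) auto
    also have "\<dots> = (\<Prod>p\<in>P. p ^ multiplicity p n)"
    proof (rule prod.mono_neutral_left[OF finP])
      show "prime_factors n \<subseteq> P" 
        using that by (auto simp: P_def in_prime_factors_iff dest!: dvd_imp_le)
      show "\<forall>p\<in>P - prime_factors n. p ^ multiplicity p n = 1"
        using that by (auto simp: P_def in_prime_factors_iff not_dvd_imp_multiplicity_0)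
    qed
    finally show ?thesis by (simp add: \<nu>_def)
  qed
  have inj: "inj_on \<nu> {1..N}"
    by (rule inj_onI) (metis fact)
  have img: "\<nu> ` {1..N} \<subseteq> PiE P (\<lambda>_. {0..N})"
  proof (rule image_subsetI)
    fix n assume n: "n \<in> {1..N}"
    have "multiplicity p n \<le> N" if "p \<in> P" for p
    proof -
      have p: "p \<ge> 2" using that prime_ge_2_nat by (auto simp: P_def)
      have "multiplicity p n < 2 ^ multiplicity p n" by (rule less_exp)
      also have "\<dots> \<le> p ^ multiplicity p n" using p by (simp add: power_mono)
      also have "\<dots> \<le> n" using n by (intro dvd_imp_le multiplicity_dvd) auto
      finally show ?thesis using n by simp
    qed
    then show "\<nu> n \<in> PiE P (\<lambda>_. {0..N})" by (auto simp: \<nu>_def)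
  qed
  have val: "norm (a n) = (\<Prod>p\<in>P. norm (a (p ^ \<nu> n p)))" if "n \<in> {1..N}" for n
  proof -
    have "a n = a (\<Prod>p\<in>P. p ^ \<nu> n p)" using fact[OF that] by simp
    also have "\<dots> = (\<Prod>p\<in>P. a (p ^ \<nu> n p))"
    proof (rule multiplicative_coeffs_prod[OF mult one finP])
      show "p ^ \<nu> n p > 0" if "p \<in> P" for p
        using that by (auto simp: P_def prime_gt_0_nat)
      show "coprime (p ^ \<nu> n p) (q ^ \<nu> n q)" if "p \<in> P" "q \<in> P" "p \<noteq> q" for p q
        using that by (auto simp: P_def primes_coprime)
    qed
    finally show ?thesis by (simp add: prod_norm)
  qed
  have "(\<Sum>n=1..N. norm (a n)) = (\<Sum>n\<in>{1..N}. \<Prod>p\<in>P. norm (a (p ^ \<nu> n p)))"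
    using val by simp
  also have "\<dots> = (\<Sum>f\<in>\<nu> ` {1..N}. \<Prod>p\<in>P. norm (a (p ^ f p)))"
    by (simp only: sum.reindex[OF inj] o_def)
  also have "\<dots> \<le> (\<Sum>f\<in>PiE P (\<lambda>_. {0..N}). \<Prod>p\<in>P. norm (a (p ^ f p)))"
    using finP by (intro sum_mono2[OF _ img] finite_PiE prod_nonneg) auto
  also have "\<dots> = (\<Prod>p\<in>P. \<Sum>k\<in>{0..N}. norm (a (p ^ k)))"
    using finP by (intro prod_sum_PiE[symmetric]) auto
  finally show ?thesis by (simp add: P_def)
qed

text \<open>
  The bound for sums over coprime integers controls one power of each prime. Taking the power with
  the coefficient of largest modulus makes it control all powers at once, and the factor \<open>n powr (-\<delta>)\<close> turns
  the sum over the powers of \<open>p\<close> into a geometric series with ratio at most \<open>2 powr (-\<delta>)\<close>.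
\<close>
lemma summable_norm_twist_if_bounded:
  assumes mult: "multiplicative_coeffs a" and one: "a 1 = 1"
    and bound: "\<And>N t. N \<ge> N0 \<Longrightarrow> norm (\<Sum>n=1..N. a n * cis (- (ln (real n) * t))) \<le> C"
    and \<delta>: "\<delta> > 0"
  shows "summable (\<lambda>n. norm (a (Suc n)) * real (Suc n) powr (- \<delta>))"
proof -
  define r where "r = 2 powr (- \<delta>)"
  have r: "0 < r" "r < 1" using \<delta> by (auto simp: r_def powr_less_one)
  \<comment> \<open>The smallest prime gives the largest ratio, so \<open>B\<close> serves all primes.\<close>
  define B where "B = 1 / (1 - r)"
  have B: "B > 0" using r by (simp add: B_def)
  have geom: "(\<Sum>k=1..N. r ^ k) \<le> B" for N
  proof -
    have "(\<Sum>k=1..N. r ^ k) \<le> (\<Sum>k. r ^ k)"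
      using r by (intro sum_le_suminf summable_geometric) auto
    then show ?thesis using r by (simp add: suminf_geometric B_def)
  qed
  define b where "b n = a n * of_real (real n powr (- \<delta>))" for n
  have b: "multiplicative_coeffs b" "b 1 = 1"
    using multiplicative_coeffs_twist[OF mult, of "- \<delta>"] one by (simp_all add: b_def[abs_def])
  have main: "(\<Sum>n=1..N. norm (b n)) \<le> exp (2 * C * B)" for N
  proof (cases "N = 0")
    case True then show ?thesis by simp
  next
    case N: False
    define P where "P = {p::nat. prime p \<and> p \<le> N}"
    have finP: "finite P" by (simp add: P_def)
    have "\<exists>k\<in>{1..N}. \<forall>j\<in>{1..N}. norm (a (p ^ j)) \<le> norm (a (p ^ k))" for p
    proof -
      let ?M = "(\<lambda>j. norm (a (p ^ j))) ` {1..N}"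
      have "Max ?M \<in> ?M" using N by (intro Max_in) auto
      then obtain k where "k \<in> {1..N}" "norm (a (p ^ k)) = Max ?M" by force
      then show ?thesis by (intro bexI[of _ k]) auto
    qed
    \<comment> \<open>\<open>p ^ \<kappa> p\<close> has the coefficient of largest modulus among the powers of \<open>p\<close> with exponent up to \<open>N\<close>.\<close>
    then obtain \<kappa> where \<kappa>: "\<And>p. \<kappa> p \<in> {1..N}"
      "\<And>p j. j \<in> {1..N} \<Longrightarrow> norm (a (p ^ j)) \<le> norm (a (p ^ \<kappa> p))" by metis
    define m where "m p = norm (a (p ^ \<kappa> p))" for p
    have prime_pow_coprime: "coprime (p ^ \<kappa> p) (q ^ \<kappa> q)" if "p \<in> P" "q \<in> P" "p \<noteq> q" for p q
      using that by (auto simp: P_def primes_coprime)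
    have pow_ge: "p ^ \<kappa> p \<ge> 2" if "p \<in> P" for p
    proof -
      have "p \<ge> 2" using that prime_ge_2_nat by (auto simp: P_def)
      also have "p = p ^ 1" by simp
      also have "p ^ 1 \<le> p ^ \<kappa> p" using \<kappa>(1)[of p] \<open>p \<ge> 2\<close> by (intro power_increasing) auto
      finally show ?thesis .
    qed
    have inj: "inj_on (\<lambda>p. p ^ \<kappa> p) P"
    proof (rule inj_onI, rule ccontr)
      fix p q assume pq: "p \<in> P" "q \<in> P" "p ^ \<kappa> p = q ^ \<kappa> q" "p \<noteq> q"
      then have "coprime (p ^ \<kappa> p) (p ^ \<kappa> p)" using prime_pow_coprime[of p q] by metis
      then have "p ^ \<kappa> p = 1" by (simp only: coprime_self nat_dvd_1_iff_1)
      then show False using pow_ge[OF pq(1)] by linarith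
    qed
    have "(\<Sum>q\<in>(\<lambda>p. p ^ \<kappa> p) ` P. norm (a q)) \<le> 2 * C"
    proof (rule sum_coprime_coeffs_le[OF mult one bound])
      show "finite ((\<lambda>p. p ^ \<kappa> p) ` P)" using finP by simp
      show "2 \<le> q" if "q \<in> (\<lambda>p. p ^ \<kappa> p) ` P" for q using that pow_ge by auto
      show "coprime q r" if "q \<in> (\<lambda>p. p ^ \<kappa> p) ` P" "r \<in> (\<lambda>p. p ^ \<kappa> p) ` P" "q \<noteq> r" for q r
        using prime_pow_coprime that by blast
    qed
    then have sum_m: "(\<Sum>p\<in>P. m p) \<le> 2 * C"
      by (simp add: sum.reindex[OF inj] m_def)
    have factor: "(\<Sum>k=0..N. norm (b (p ^ k))) \<le> exp (m p * B)" if p: "p \<in> P" for p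
    proof -
      have p2: "p \<ge> 2" using p prime_ge_2_nat by (auto simp: P_def)
      have "norm (b (p ^ k)) \<le> m p * r ^ k" if k: "k \<in> {1..N}" for k
      proof -
        have "real (p ^ k) powr (- \<delta>) = (real p powr (- \<delta>)) ^ k"
          using p2 by (simp add: powr_power powr_powr flip: powr_realpow)
             (simp add: mult.commute)
        also have "\<dots> \<le> r ^ k"
          unfolding r_def using p2 \<delta> by (intro power_mono powr_mono2') auto
        finally show ?thesis
          using \<kappa>(2)[OF k, of p] by (simp add: b_def norm_mult m_def mult_mono)
      qed
      then have "(\<Sum>k=1..N. norm (b (p ^ k))) \<le> (\<Sum>k=1..N. m p * r ^ k)"
        by (intro sum_mono)
      also have "\<dots> \<le> m p * B"
        using geom[of N] by (simp add: sum_distrib_left[symmetric] m_def mult_left_mono)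
      finally have "(\<Sum>k=0..N. norm (b (p ^ k))) \<le> 1 + m p * B"
        using b(2) by (simp add: sum.atLeast_Suc_atMost)
      also have "\<dots> \<le> exp (m p * B)" by (rule exp_ge_add_one_self)
      finally show ?thesis .
    qed
    have "(\<Sum>n=1..N. norm (b n)) \<le> (\<Prod>p\<in>P. \<Sum>k=0..N. norm (b (p ^ k)))"
      unfolding P_def by (rule sum_norm_le_euler_product[OF b])
    also have "\<dots> \<le> (\<Prod>p\<in>P. exp (m p * B))"
      using factor by (intro prod_mono) (auto intro: sum_nonneg)
    also have "\<dots> = exp ((\<Sum>p\<in>P. m p) * B)"
      using finP by (simp add: exp_sum sum_distrib_right)
    also have "\<dots> \<le> exp (2 * C * B)" using sum_m B by simp
    finally show ?thesis .
  qed
  have "summable (\<lambda>n. norm (b (Suc n)))"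
  proof (rule summableI_nonneg_bounded)
    show "(\<Sum>i<n. norm (b (Suc i))) \<le> exp (2 * C * B)" for n
      using main[of n] by (simp add: sum.shift_bounds_cl_Suc_ivl sum.atLeast1_atMost_eq)
  qed simp
  then show ?thesis by (simp add: b_def norm_mult)
qed

section \<open>Comparison of the two abscissas\<close>

lemma of_nat_powr_minus_Complex:
  assumes "n > 0"
  shows "of_nat n powr (- Complex \<sigma> t) = of_real (real n powr (- \<sigma>)) * cis (- (ln (real n) * t))"
proof -
  have "of_nat n powr (- Complex \<sigma> t) = exp (- Complex \<sigma> t * of_real (ln (real n)))"
    using assms by (simp add: powr_def Ln_of_nat)
  also have "- Complex \<sigma> t * of_real (ln (real n)) = of_real (- \<sigma> * ln (real n)) + \<i> * of_real (- (ln (real n) * t))"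
    by (simp add: complex_eq_iff mult.commute)
  also have "exp \<dots> = of_real (real n powr (- \<sigma>)) * cis (- (ln (real n) * t))"
    using assms by (simp only: exp_add cis_conv_exp powr_def exp_of_real) simp
  finally show ?thesis .
qed

text \<open>
  Beyond some \<open>N0\<close> all partial sums are within distance \<open>2\<close> of the one at \<open>N0\<close>, and a single Dirichlet
  polynomial is bounded on a vertical line by the sum of the moduli of its terms.
\<close>
lemma uniformly_convergent_imp_eventually_bounded:
  assumes "uniformly_convergent_on UNIV (\<lambda>N t. dirichlet_partial_sum a N (Complex \<sigma> t))"
  obtains N0 C where "\<And>N t. N \<ge> N0 \<Longrightarrow> norm (dirichlet_partial_sum a N (Complex \<sigma> t)) \<le> C"
proof -
  let ?S = "\<lambda>N t. dirichlet_partial_sum a N (Complex \<sigma> t)"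
  obtain l where "uniform_limit UNIV ?S l sequentially"
    using assms by (auto simp: uniformly_convergent_on_def)
  then have "eventually (\<lambda>N. \<forall>t\<in>UNIV. dist (?S N t) (l t) < 1) sequentially"
    by (rule uniform_limitD) simp
  then obtain N0 where N0: "\<And>N t. N \<ge> N0 \<Longrightarrow> dist (?S N t) (l t) < 1"
    by (auto simp: eventually_sequentially)
  define D where "D = (\<Sum>n=1..N0. norm (a n) * real n powr (- \<sigma>))"
  have D: "norm (?S N0 t) \<le> D" for t
    unfolding dirichlet_partial_sum_def D_def
    by (rule sum_norm_le) (simp add: of_nat_powr_minus_Complex norm_mult)
  have "norm (?S N t) \<le> D + 2" if "N \<ge> N0" for N t
  proof -
    have "dist (?S N t) (?S N0 t) < 2"
      using N0[OF that, of t] N0[of N0 t] dist_triangle2[of "?S N t" "?S N0 t" "l t"] by simp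
    then show ?thesis using D[of t] norm_triangle_sub[of "?S N t" "?S N0 t"]
      by (simp add: dist_norm)
  qed
  then show thesis by (rule that)
qed

lemma uniformly_convergent_if_summable:
  assumes "summable (\<lambda>n. norm (a (Suc n)) * real (Suc n) powr (- \<sigma>))"
  shows "uniformly_convergent_on UNIV (\<lambda>N t. dirichlet_partial_sum a N (Complex \<sigma> t))"
proof -
  have "uniformly_convergent_on UNIV
          (\<lambda>N t. \<Sum>n<N. a (Suc n) * of_nat (Suc n) powr (- Complex \<sigma> t))"
    by (rule Weierstrass_m_test'[OF _ assms])
       (simp add: of_nat_powr_minus_Complex norm_mult del: of_nat_Suc)
  then show ?thesis
    by (simp add: dirichlet_partial_sum_def sum.atLeast1_atMost_eq)
qed

text \<open>
  If \<open>a 1 \<noteq> 0\<close>, then \<open>a 1 = a 1 * a 1\<close> gives \<open>a 1 = 1\<close>, and moving the line of uniform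
  convergence to the imaginary axis reduces the claim to partial sums bounded there.
\<close>
lemma summable_if_uniformly_convergent:
  assumes mult: "multiplicative_coeffs a"
    and conv: "uniformly_convergent_on UNIV (\<lambda>N t. dirichlet_partial_sum a N (Complex \<sigma> t))"
    and less: "\<sigma> < \<sigma>'"
  shows "summable (\<lambda>n. norm (a (Suc n)) * real (Suc n) powr (- \<sigma>'))"
proof (cases "a 1 = 0")
  case True
  have "a (Suc n) = 0" for n
    using mult True unfolding multiplicative_coeffs_def
    by (metis coprime_1_left mult_1 mult_zero_left zero_less_Suc zero_less_one)
  then show ?thesis by simp
next
  case False
  have "a (1 * 1) = a 1 * a 1"
    using mult unfolding multiplicative_coeffs_def by (metis coprime_1_left zero_less_one)
  with False have one: "a 1 = 1" by simp
  define b where "b n = a n * of_real (real n powr (- \<sigma>))" for n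
  have b: "multiplicative_coeffs b" "b 1 = 1"
    using multiplicative_coeffs_twist[OF mult, of "- \<sigma>"] one by (simp_all add: b_def[abs_def])
  have S: "dirichlet_partial_sum a N (Complex \<sigma> t) = (\<Sum>n=1..N. b n * cis (- (ln (real n) * t)))" for N t
    unfolding dirichlet_partial_sum_def
    by (intro sum.cong) (auto simp: of_nat_powr_minus_Complex b_def)
  obtain N0 C where
    "\<And>N t. N \<ge> N0 \<Longrightarrow> norm (\<Sum>n=1..N. b n * cis (- (ln (real n) * t))) \<le> C"
    using uniformly_convergent_imp_eventually_bounded[OF conv] unfolding S by blast
  from summable_norm_twist_if_bounded[OF b this, where \<delta> = "\<sigma>' - \<sigma>"] less
  have "summable (\<lambda>n. norm (b (Suc n)) * real (Suc n) powr (- (\<sigma>' - \<sigma>)))" by simp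
  then show ?thesis
    by (simp add: b_def norm_mult mult.assoc flip: powr_add del: of_nat_Suc)
qed

theorem theorem2:
  fixes a :: "nat \<Rightarrow> complex"
  assumes "multiplicative_coeffs a"
  shows "abscissa_abs_conv a = abscissa_unif_conv a"
proof (rule antisym)
  show "abscissa_unif_conv a \<le> abscissa_abs_conv a"
    unfolding abscissa_unif_conv_def abscissa_abs_conv_def
    by (intro Inf_superset_mono image_mono Collect_mono impI uniformly_convergent_if_summable)
  show "abscissa_abs_conv a \<le> abscissa_unif_conv a"
    unfolding abscissa_unif_conv_def
  proof (rule Inf_greatest, clarify)
    fix \<sigma> assume conv: "uniformly_convergent_on UNIV (\<lambda>N t. dirichlet_partial_sum a N (Complex \<sigma> t))"
    show "abscissa_abs_conv a \<le> ereal \<sigma>"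
    proof (rule ereal_le_epsilon2)
      fix \<epsilon> :: real assume "\<epsilon> > 0"
      then have "summable (\<lambda>n. norm (a (Suc n)) * real (Suc n) powr (- (\<sigma> + \<epsilon>)))"
        by (intro summable_if_uniformly_convergent[OF assms conv]) simp
      then have "abscissa_abs_conv a \<le> ereal (\<sigma> + \<epsilon>)"
        unfolding abscissa_abs_conv_def by (intro Inf_lower imageI) simp
      then show "abscissa_abs_conv a \<le> ereal \<sigma> + ereal \<epsilon>" by simp
    qed
  qed
qed

end
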